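(* Let $(G,\chi)$ be a 2-connected ribbon graph. For any $T^{start},T^{goal}\in\mathcal{T}(G)$, there exists a (finite) sequence of source-turn moves whose composition maps $T^{start}$ to $T^{goal}$.
   Context: All graphs are finite, connected and undirected; parallel edges are allowed, loops are not. A graph is 2-connected if it has no cut vertices. For an edge $e$, $\mathfrak{i}(e)$ is the set of its two endpoints. $\mathcal{T}(G)$ is the set of spanning trees of $G$, viewed as subsets of $E(G)$. A ribbon structure $\chi$ on $G$ assigns to each $v\in V(G)$ a cyclic order $\chi(v)$ of the edges incident to $v$; $(G,\chi)$ is a ribbon graph; for $e$ incident to $x$, $\chi(x,e)$ is the edge following $e$ in $\chi(x)$. A rotor configuration with sink $s$ assigns to each $x\in V(G)\setminus s$ an incident edge $\rho\langle x\rangle$. For $T\in\mathcal{T}(G)$ and $s\in V(G)$, $T_s\langle x\rangle$ is the first edge on the path in $T$ from $x$ to $s$. Single-chip rotor-routing with input $T$ and $c-s$: start with $\rho=T_s$ and a chip at $c$; while the chip is at $x\neq s$, replace $\rho\langle x\rangle$ by $\chi(x,\rho\langle x\rangle)$ and then move the chip across the new edge $\rho\langle x\rangle$. By known results this terminates with a configuration $T'_s$ for a unique $T'\in\mathcal{T}(G)$; set $\hat r_{(G,\chi,s)}(c-s,T)=T'$. A leaf vertex of $T$ is a vertex incident to exactly one edge of $T$. For $c,s\in V(G)$ and $T\in\mathcal{T}(G)$, the pair $(c-s,T)$ is a source-turn pair at $c$ if $c$ is a leaf vertex of $T$ and $\{c,s\}=\mathfrak{i}(\chi(c,T_s\langle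 c\rangle))$. The corresponding source-turn move at $c$ is the map taking $T$ to $\hat r_{(G,\chi,s)}(c-s,T)$. (Explicitly, if $g$ is the unique edge of $T$ at $c$ and $f=\chi(c,g)$, this move takes $T$ to $(T\setminus g)\cup f$.) *)

theory Defs
  imports "HOL-Library.FuncSet" "HOL-Combinatorics.Orbits"
begin

record ('v, 'e) multigraph =
  verts :: "'v set"
  edges :: "'e set"
  ends :: "'e \<Rightarrow> 'v set"

text \<open>A walk from \<open>x\<close> is recorded as the list of its steps (edge traversed, vertex reached).\<close>

fun walk :: "('v, 'e) multigraph \<Rightarrow> 'e set \<Rightarrow> 'v \<Rightarrow> ('e \<times> 'v) list \<Rightarrow> 'v \<Rightarrow> bool" where
  "walk G A x [] y \<longleftrightarrow> x = y"
| "walk G A x ((e, v) # p) y \<longleftrightarrow> e \<in> A \<and> ends G e = {x, v} \<and> walk G A v p y"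

definition path :: "('v, 'e) multigraph \<Rightarrow> 'e set \<Rightarrow> 'v \<Rightarrow> ('e \<times> 'v) list \<Rightarrow> 'v \<Rightarrow> bool" where
  "path G A x p y \<longleftrightarrow> walk G A x p y \<and> distinct (x # map snd p)"

text \<open>Distinctness of the edges excludes going back and forth along one edge, while two parallel
  edges do form a cycle.\<close>

definition cycle :: "('v, 'e) multigraph \<Rightarrow> 'e set \<Rightarrow> 'v \<Rightarrow> ('e \<times> 'v) list \<Rightarrow> bool" where
  "cycle G A x p \<longleftrightarrow> p \<noteq> [] \<and> walk G A x p x \<and> distinct (map fst p) \<and> distinct (map snd p)"

definition connected_on :: "('v, 'e) multigraph \<Rightarrow> 'v set \<Rightarrow> 'e set \<Rightarrow> bool" where
  "connected_on G W A \<longleftrightarrow> (\<forall>x\<in>W. \<forall>y\<in>W. \<exists>p. walk G A x p y)"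

definition graph :: "('v, 'e) multigraph \<Rightarrow> bool" where
  "graph G \<longleftrightarrow>
     finite (verts G) \<and> verts G \<noteq> {} \<and> finite (edges G) \<and>
     (\<forall>e\<in>edges G. ends G e \<subseteq> verts G \<and> card (ends G e) = 2) \<and>
     connected_on G (verts G) (edges G)"

definition cut_vertex :: "('v, 'e) multigraph \<Rightarrow> 'v \<Rightarrow> bool" where
  "cut_vertex G v \<longleftrightarrow>
     v \<in> verts G \<and> \<not> connected_on G (verts G - {v}) {e \<in> edges G. v \<notin> ends G e}"

definition two_connected :: "('v, 'e) multigraph \<Rightarrow> bool" where
  "two_connected G \<longleftrightarrow> graph G \<and> (\<forall>v\<in>verts G. \<not> cut_vertex G v)"

definition spanning_trees :: "('v, 'e) multigraph \<Rightarrow> 'e set set" where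
  "spanning_trees G =
     {T. T \<subseteq> edges G \<and> connected_on G (verts G) T \<and> (\<nexists>x p. cycle G T x p)}"

definition incident :: "('v, 'e) multigraph \<Rightarrow> 'v \<Rightarrow> 'e set" where
  "incident G v = {e \<in> edges G. v \<in> ends G e}"

text \<open>A cyclic order on a finite nonempty set is given by its successor function: one whose
  restriction to the set is a permutation with a single orbit. The set of edges incident to a vertex
  is empty only in the one-vertex graph. Values of \<open>\<chi> v\<close> off \<open>incident G v\<close> are irrelevant.\<close>

definition ribbon_structure :: "('v, 'e) multigraph \<Rightarrow> ('v \<Rightarrow> 'e \<Rightarrow> 'e) \<Rightarrow> bool" where
  "ribbon_structure G \<chi> \<longleftrightarrow>
     (\<forall>v\<in>verts G. incident G v \<noteq> {} \<longrightarrow> cyclic_on (\<chi> v) (incident G v))"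

definition ribbon_graph :: "('v, 'e) multigraph \<Rightarrow> ('v \<Rightarrow> 'e \<Rightarrow> 'e) \<Rightarrow> bool" where
  "ribbon_graph G \<chi> \<longleftrightarrow> graph G \<and> ribbon_structure G \<chi>"

text \<open>\<open>tree_rotor G T s\<close> is the rotor configuration \<open>T\<^sub>s\<close> with sink \<open>s\<close>; it is \<open>undefined\<close> outside
  \<open>verts G - {s}\<close>, so that equality of configurations is equality of functions.\<close>

definition tree_rotor :: "('v, 'e) multigraph \<Rightarrow> 'e set \<Rightarrow> 'v \<Rightarrow> 'v \<Rightarrow> 'e" where
  "tree_rotor G T s = (\<lambda>x\<in>verts G - {s}. fst (hd (THE p. path G T x p s)))"

text \<open>States of the rotor-routing process are pairs (rotor configuration, position of the chip).\<close>

inductive rotor_step ::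
  "('v, 'e) multigraph \<Rightarrow> ('v \<Rightarrow> 'e \<Rightarrow> 'e) \<Rightarrow> 'v \<Rightarrow> ('v \<Rightarrow> 'e) \<times> 'v \<Rightarrow> ('v \<Rightarrow> 'e) \<times> 'v \<Rightarrow> bool"
  for G \<chi> s where
  "\<lbrakk>x \<noteq> s; \<rho>' = \<rho>(x := \<chi> x (\<rho> x)); ends G (\<rho>' x) = {x, y}\<rbrakk>
     \<Longrightarrow> rotor_step G \<chi> s (\<rho>, x) (\<rho>', y)"

text \<open>\<open>rotor_route G \<chi> s c T\<close> is the tree obtained by single-chip rotor-routing with input \<open>T\<close> and
  the divisor \<open>c - s\<close>.\<close>

definition rotor_route ::
  "('v, 'e) multigraph \<Rightarrow> ('v \<Rightarrow> 'e \<Rightarrow> 'e) \<Rightarrow> 'v \<Rightarrow> 'v \<Rightarrow> 'e set \<Rightarrow> 'e set" where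
  "rotor_route G \<chi> s c T =
     (THE T'. T' \<in> spanning_trees G \<and>
        (rotor_step G \<chi> s)\<^sup>*\<^sup>* (tree_rotor G T s, c) (tree_rotor G T' s, s))"

definition leaf_vertex :: "('v, 'e) multigraph \<Rightarrow> 'e set \<Rightarrow> 'v \<Rightarrow> bool" where
  "leaf_vertex G T v \<longleftrightarrow> v \<in> verts G \<and> card {e \<in> T. v \<in> ends G e} = 1"

text \<open>The condition \<open>c \<noteq> s\<close> is implicit in the use of \<open>T\<^sub>s\<close> at \<open>c\<close>; it must be stated because
  \<open>tree_rotor G T s s\<close> is an unspecified value.\<close>

definition source_turn_pair ::
  "('v, 'e) multigraph \<Rightarrow> ('v \<Rightarrow> 'e \<Rightarrow> 'e) \<Rightarrow> 'v \<Rightarrow> 'v \<Rightarrow> 'e set \<Rightarrow> bool" where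
  "source_turn_pair G \<chi> c s T \<longleftrightarrow>
     c \<in> verts G \<and> s \<in> verts G \<and> c \<noteq> s \<and> T \<in> spanning_trees G \<and>
     leaf_vertex G T c \<and> {c, s} = ends G (\<chi> c (tree_rotor G T s c))"

definition source_turn_move ::
  "('v, 'e) multigraph \<Rightarrow> ('v \<Rightarrow> 'e \<Rightarrow> 'e) \<Rightarrow> 'e set \<Rightarrow> 'e set \<Rightarrow> bool" where
  "source_turn_move G \<chi> T T' \<longleftrightarrow>
     (\<exists>c s. source_turn_pair G \<chi> c s T \<and> T' = rotor_route G \<chi> s c T)"

end

theory Submission imports Defs begin

text \<open>
  Grow a common subtree. Let \<open>S\<close> be a subtree with vertex set \<open>U\<close>; by induction on the number of
  vertices outside \<open>U\<close>, any two spanning trees containing \<open>S\<close> are linked by moves. A spanning tree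
  containing \<open>S\<close> uses an edge leaving \<open>U\<close>, and by induction all spanning trees containing \<open>S\<close> and a
  given such edge are linked. Two edges leaving \<open>U\<close> towards different vertices lie in a common
  spanning tree containing \<open>S\<close>, so their classes coincide; for two edges with the same outer end
  \<open>w\<close>, a third edge leaving \<open>U\<close> towards another vertex links the classes. If there is no such edge,
  then \<open>w\<close> is the only vertex outside \<open>U\<close>, as it would be a cut vertex otherwise; now \<open>w\<close> is a leaf
  in both trees and is turned along the cyclic order.
\<close>

section \<open>Reachability, walks and paths\<close>

text \<open>Existence of a walk as a reflexive transitive closure, so that symmetry, transitivity
  and induction come from \<open>rtranclp\<close>.\<close>

definition reach :: "('v, 'e) multigraph \<Rightarrow> 'e set \<Rightarrow> 'v \<Rightarrow> 'v \<Rightarrow> bool" where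
  "reach G A = (\<lambda>x y. \<exists>e\<in>A. ends G e = {x, y})\<^sup>*\<^sup>*"

lemma reach_refl [simp]: "reach G A x x"
  by (simp add: reach_def)

lemma reach_edge: "e \<in> A \<Longrightarrow> ends G e = {x, y} \<Longrightarrow> reach G A x y"
  unfolding reach_def by blast

lemma reach_trans: "reach G A x y \<Longrightarrow> reach G A y z \<Longrightarrow> reach G A x z"
  unfolding reach_def by (rule rtranclp_trans)

lemma reach_sym:
  assumes "reach G A x y"
  shows "reach G A y x"
proof -
  have "symp (\<lambda>x y. \<exists>e\<in>A. ends G e = {x, y})"
    by (auto simp: symp_def insert_commute)
  from sympD[OF symp_rtranclp[OF this]] show ?thesis
    using assms unfolding reach_def .
qed

lemma reach_mono:
  assumes "reach G A x y" "A \<subseteq> B"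
  shows "reach G B x y"
  using assms(1) unfolding reach_def
  by (rule rtranclp_mono[THEN predicate2D, rotated]) (use assms(2) in blast)

text \<open>Each edge of \<open>A\<close> need only map to reachability in \<open>B\<close>,
  possibly trivial, so \<open>\<phi>\<close> may contract an edge.\<close>

lemma reach_map:
  assumes "reach G A x y"
    and "\<And>e a b. e \<in> A \<Longrightarrow> ends G e = {a, b} \<Longrightarrow> reach G B (\<phi> a) (\<phi> b)"
  shows "reach G B (\<phi> x) (\<phi> y)"
  using assms(1) unfolding reach_def[of G A]
proof (induction rule: rtranclp_induct)
  case (step y z)
  then show ?case using assms(2) reach_trans by metis
qed simp

lemma walk_imp_reach: "walk G A x p y \<Longrightarrow> reach G A x y"
proof (induction p arbitrary: x)
  case (Cons a p)
  obtain e v where "a = (e, v)" by (cases a)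
  then have "reach G A x v" "reach G A v y" using Cons by (auto intro: reach_edge)
  then show ?case by (rule reach_trans)
qed simp

lemma walk_mono: "walk G A x p y \<Longrightarrow> A \<subseteq> B \<Longrightarrow> walk G B x p y"
  by (induction p arbitrary: x) auto

lemma walk_edges: "walk G A x p y \<Longrightarrow> fst ` set p \<subseteq> A"
  by (induction p arbitrary: x) (simp, fastforce)

lemma walk_restrict: "walk G A x p y \<Longrightarrow> fst ` set p \<subseteq> B \<Longrightarrow> walk G B x p y"
  by (induction p arbitrary: x) auto

lemma walk_ends: "walk G A x p y \<Longrightarrow> e \<in> fst ` set p \<Longrightarrow> ends G e \<subseteq> set (x # map snd p)"
proof (induction p arbitrary: x)
  case (Cons a p)
  obtain f v where "a = (f, v)" by (cases a)
  then show ?case using Cons.IH[of v] Cons.prems by auto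
qed simp

lemma path_suffix:
  assumes "path G A x p y" "z \<in> set (x # map snd p)"
  shows "\<exists>q. path G A z q y"
  using assms
proof (induction p arbitrary: x)
  case Nil
  then show ?case by (auto simp: path_def intro: exI[of _ "[]"])
next
  case (Cons a p)
  obtain e v where a: "a = (e, v)" by (cases a)
  show ?case
  proof (cases "z = x")
    case False
    then show ?thesis using Cons.IH[of v] Cons.prems a by (auto simp: path_def)
  qed (use Cons.prems in blast)
qed

text \<open>Loop erasure: if the path built so far already visits the vertex to be put in front, its
  suffix from that vertex is taken instead.\<close>

lemma reach_imp_path:
  assumes "reach G A x y"
  shows "\<exists>p. path G A x p y"
  using assms unfolding reach_def
proof (induction rule: converse_rtranclp_induct)
  case base
  show ?case by (rule exI[of _ "[]"]) (simp add: path_def)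
next
  case (step x v)
  then obtain e p where e: "e \<in> A" "ends G e = {x, v}" and p: "path G A v p y" by blast
  show ?case
  proof (cases "x \<in> set (v # map snd p)")
    case True
    then show ?thesis using path_suffix p by metis
  next
    case False
    then show ?thesis using e p by (intro exI[of _ "(e, v) # p"]) (auto simp: path_def)
  qed
qed

lemma connected_on_iff_reach:
  "connected_on G W A \<longleftrightarrow> (\<forall>x\<in>W. \<forall>y\<in>W. reach G A x y)"
  unfolding connected_on_def by (meson path_def reach_imp_path walk_imp_reach)

lemma reach_imp_path_Cons:
  assumes "reach G A x y" "x \<noteq> y"
  obtains e v p where "path G A x ((e, v) # p) y"
proof -
  obtain p where p: "path G A x p y" using reach_imp_path[OF assms(1)] by blast
  with assms(2) have "p \<noteq> []" by (auto simp: path_def)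
  then show thesis using p that by (cases p) auto
qed

lemma reach_boundary:
  assumes "reach G A x y" "x \<in> U" "y \<notin> U"
  shows "\<exists>e\<in>A. \<exists>a b. ends G e = {a, b} \<and> a \<in> U \<and> b \<notin> U"
  using assms unfolding reach_def
  by (induction rule: rtranclp_induct) blast+

text \<open>The last fact holds because a path never returns to its first vertex; in particular the
  first edge does not recur.\<close>

lemma path_ConsD:
  assumes "path G A x ((e, v) # p) y"
  shows "e \<in> A" "ends G e = {x, v}" "path G A v p y" "x \<noteq> v"
    and "f \<in> fst ` set p \<Longrightarrow> x \<notin> ends G f"
  using assms walk_ends[of G A v p y f] by (auto simp: path_def)

lemma path_mono: "path G A x p y \<Longrightarrow> A \<subseteq> B \<Longrightarrow> path G B x p y"
  unfolding path_def using walk_mono[of G A x p y B] by simp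

lemma path_distinct_edges:
  "path G A x p y \<Longrightarrow> distinct (map fst p)"
proof (induction p arbitrary: x)
  case (Cons a p)
  obtain e v where a: "a = (e, v)" by (cases a)
  then show ?case using Cons.IH[of v] Cons.prems path_ConsD[of G A x e v p y] by auto
qed simp

section \<open>Acyclicity, unique paths and minimality of spanning trees\<close>

text \<open>Otherwise a path in \<open>A\<close> from \<open>y\<close> to \<open>x\<close> avoids
  \<open>e\<close>, and \<open>e\<close> closes it to a cycle in \<open>T\<close>.\<close>

lemma acyclic_not_reach:
  assumes "\<nexists>x p. cycle G T x p" "e \<in> T" "ends G e = {x, y}" "A \<subseteq> T" "e \<notin> A"
  shows "\<not> reach G A x y"
proof
  assume "reach G A x y"
  then obtain p where p: "path G A y p x" using reach_sym reach_imp_path by metis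
  then have "e \<notin> fst ` set p" using walk_edges assms(5) unfolding path_def by fast
  then have "cycle G T x ((e, y) # p)"
    using p path_distinct_edges[OF p] assms walk_mono[of G A y p x T]
    by (auto simp: cycle_def path_def)
  then show False using assms(1) by blast
qed

text \<open>Once the first edge of a cycle is removed, the rest of the cycle still joins the ends of
  that edge.\<close>

lemma acyclicI:
  assumes "\<And>e x y. e \<in> T \<Longrightarrow> ends G e = {x, y} \<Longrightarrow> \<not> reach G (T - {e}) x y"
  shows "\<nexists>x p. cycle G T x p"
proof
  assume "\<exists>x p. cycle G T x p"
  then obtain x p where c: "cycle G T x p" by blast
  then obtain e v q where p: "p = (e, v) # q" by (metis cycle_def neq_Nil_conv surj_pair)
  have e: "e \<in> T" "ends G e = {x, v}" and q: "walk G T v q x" and "e \<notin> fst ` set q"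
    using c unfolding p cycle_def by simp_all
  then have "walk G (T - {e}) v q x"
    using walk_edges[OF q] by (intro walk_restrict[OF q]) blast
  then have "reach G (T - {e}) x v" by (intro reach_sym[OF walk_imp_reach])
  then show False using assms[OF e] by blast
qed

lemma walk_last: "walk G A x p y \<Longrightarrow> y \<in> set (x # map snd p)"
proof (induction p arbitrary: x)
  case Nil
  then have "x = y" by simp
  then show ?case by simp
next
  case (Cons a p)
  obtain e v where a: "a = (e, v)" by (cases a)
  then have "walk G A v p y" using Cons.prems by simp
  then have "y \<in> set (v # map snd p)" by (rule Cons.IH)
  then show ?case unfolding a by simp
qed

lemma path_closed: "path G A x p x \<Longrightarrow> p = []"
proof (cases p)
  case (Cons a q)
  obtain e v where "a = (e, v)" by (cases a)
  moreover assume "path G A x p x"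
  ultimately show ?thesis using Cons walk_last[of G A v q x] by (simp add: path_def)
qed

lemma path_Cons_neq: "path G A x (a # p) y \<Longrightarrow> x \<noteq> y"
  using path_closed[of G A x "a # p"] by auto

text \<open>If the first edges \<open>e\<close> and \<open>f\<close> differ, neither tail uses
  \<open>e\<close>, as neither returns to \<open>x\<close>. Then \<open>f\<close>, the tail from
  \<open>w\<close> to \<open>y\<close> and the reversed tail from \<open>y\<close> to
  \<open>v\<close> join the ends of \<open>e\<close> without \<open>e\<close>, contradicting
  acyclicity.\<close>

lemma path_unique:
  assumes "\<nexists>x p. cycle G T x p" "path G T x p y" "path G T x q y"
  shows "p = q"
  using assms(2,3)
proof (induction p arbitrary: x q)
  case Nil
  then have "path G T x q x" by (simp add: path_def)
  then show ?case using path_closed by fastforce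
next
  case (Cons a p)
  obtain e v where a: "a = (e, v)" by (cases a)
  note P = path_ConsD[OF Cons.prems(1)[unfolded a]]
  obtain f w r where q: "q = (f, w) # r"
    using Cons.prems path_closed[of G T x "a # p"] by (cases q) (auto simp: path_def)
  note Q = path_ConsD[OF Cons.prems(2)[unfolded q]]
  show ?case
  proof (cases "e = f")
    case True
    then have "v = w" using P(2) Q(2) by (auto simp: doubleton_eq_iff)
    then show ?thesis using Cons.IH P(3) Q(3) True a q by blast
  next
    case False
    have "x \<in> ends G e" using P(2) by simp
    then have "e \<notin> fst ` set p" "e \<notin> fst ` set r" using P(5) Q(5) by blast+
    moreover have "walk G T v p y" "walk G T w r y" using P(3) Q(3) by (simp_all add: path_def)
    ultimately have "walk G (T - {e}) v p y" "walk G (T - {e}) w r y"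
      using walk_edges[of G T v p y] walk_edges[of G T w r y]
        walk_restrict[of G T v p y "T - {e}"] walk_restrict[of G T w r y "T - {e}"] by blast+
    moreover have "reach G (T - {e}) x w" using Q(1,2) False by (auto intro: reach_edge)
    ultimately have "reach G (T - {e}) x v"
      by (blast intro: walk_imp_reach reach_sym reach_trans)
    then show ?thesis using acyclic_not_reach[OF assms(1) P(1,2), of "T - {e}"] by blast
  qed
qed

text \<open>An edge of \<open>T\<close> missing from \<open>A\<close> would have its ends joined
  inside \<open>A\<close>. This identifies spanning trees from an inclusion, without counting
  edges.\<close>

lemma spanning_tree_minimal:
  assumes "graph G" "T \<in> spanning_trees G" "A \<subseteq> T" "connected_on G (verts G) A"
  shows "A = T"
proof (rule ccontr)
  assume "A \<noteq> T"
  then obtain e where e: "e \<in> T" "e \<notin> A" using assms(3) by blast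
  then have "e \<in> edges G" using assms(2) by (auto simp: spanning_trees_def)
  then have "card (ends G e) = 2" "ends G e \<subseteq> verts G" using assms(1) by (auto simp: graph_def)
  then obtain x y where xy: "ends G e = {x, y}" "x \<in> verts G" "y \<in> verts G"
    by (auto simp: card_2_iff)
  show False
    using acyclic_not_reach[OF _ e(1) xy(1) assms(3) e(2)] assms(2,4) xy(2,3)
    by (auto simp: spanning_trees_def connected_on_iff_reach)
qed

section \<open>Rotor configurations of spanning trees\<close>

text \<open>Uniqueness of paths resolves the \<open>THE\<close> in \<open>tree_rotor\<close>, so any
  path at hand can be used to read off the rotor.\<close>

lemma tree_rotor_eq:
  assumes "T \<in> spanning_trees G" "path G T x ((e, v) # p) s" "x \<in> verts G"
  shows "tree_rotor G T s x = e"
proof -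
  have "\<nexists>x p. cycle G T x p" using assms(1) by (simp add: spanning_trees_def)
  from path_unique[OF this _ assms(2)] have "(THE q. path G T x q s) = (e, v) # p"
    by (intro the_equality assms(2))
  moreover have "x \<noteq> s" by (rule path_Cons_neq[OF assms(2)])
  ultimately show ?thesis by (simp add: tree_rotor_def assms(3))
qed

text \<open>Each suffix of the path is the path to \<open>s\<close> from its own first vertex, so
  every edge is the rotor at the vertex it leaves.\<close>

lemma path_edges_subset_tree_rotor:
  assumes "graph G" "T \<in> spanning_trees G" "path G T x p s" "x \<in> verts G"
  shows "fst ` set p \<subseteq> tree_rotor G T s ` (verts G - {s})"
  using assms(3,4)
proof (induction p arbitrary: x)
  case (Cons a p)
  obtain e v where a: "a = (e, v)" by (cases a)
  note P = path_ConsD[OF Cons.prems(1)[unfolded a]]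
  have "e \<in> edges G" using assms(2) P(1) by (auto simp: spanning_trees_def)
  then have "v \<in> verts G" using assms(1) P(2) by (auto simp: graph_def)
  then have "fst ` set p \<subseteq> tree_rotor G T s ` (verts G - {s})" by (rule Cons.IH[OF P(3)])
  moreover have "x \<noteq> s" by (rule path_Cons_neq[OF Cons.prems(1)])
  then have "e \<in> tree_rotor G T s ` (verts G - {s})"
    using tree_rotor_eq[OF assms(2) Cons.prems(1)[unfolded a] Cons.prems(2)] Cons.prems(2)
    by (intro image_eqI[of _ _ x]) auto
  ultimately show ?case by (simp add: a)
qed simp

text \<open>The rotors are edges of \<open>T\<close> and already connect every vertex to
  \<open>s\<close>, so minimality applies. The tree can thus be recovered from its configuration,
  which gives the uniqueness needed for \<open>rotor_route\<close>.\<close>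

lemma tree_rotor_image:
  assumes "graph G" "T \<in> spanning_trees G" "s \<in> verts G"
  shows "tree_rotor G T s ` (verts G - {s}) = T"
proof (rule spanning_tree_minimal[OF assms(1,2)])
  have r: "reach G T x s" if "x \<in> verts G" for x
    using assms(2,3) that by (auto simp: spanning_trees_def connected_on_iff_reach)
  show "tree_rotor G T s ` (verts G - {s}) \<subseteq> T"
  proof
    fix g assume "g \<in> tree_rotor G T s ` (verts G - {s})"
    then obtain x where x: "x \<in> verts G" "x \<noteq> s" "g = tree_rotor G T s x" by blast
    from reach_imp_path_Cons[OF r[OF x(1)] x(2)]
    obtain e v p where p: "path G T x ((e, v) # p) s" .
    then show "g \<in> T" using tree_rotor_eq[OF assms(2) p x(1)] path_ConsD(1)[OF p] x(3) by simp
  qed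
  let ?A = "tree_rotor G T s ` (verts G - {s})"
  have "reach G ?A x s" if x: "x \<in> verts G" for x
  proof -
    obtain p where p: "path G T x p s" using reach_imp_path[OF r[OF x]] by blast
    then have "walk G T x p s" by (simp add: path_def)
    from walk_restrict[OF this path_edges_subset_tree_rotor[OF assms(1,2) p x]]
    show ?thesis by (rule walk_imp_reach)
  qed
  from reach_trans[OF this reach_sym[OF this]] show "connected_on G (verts G) ?A"
    unfolding connected_on_iff_reach by (intro ballI)
qed

section \<open>Subtrees grown by pendant edges\<close>

text \<open>Trees on a vertex set \<open>U\<close>, generated by adding one leaf at a time, so that
  connectedness and acyclicity follow by rule induction.\<close>

inductive subtree :: "('v, 'e) multigraph \<Rightarrow> 'v set \<Rightarrow> 'e set \<Rightarrow> bool" for G where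
  single: "v \<in> verts G \<Longrightarrow> subtree G {v} {}"
| extend: "\<lbrakk>subtree G U S; e \<in> edges G; ends G e = {u, w}; u \<in> U; w \<in> verts G - U\<rbrakk>
     \<Longrightarrow> subtree G (insert w U) (insert e S)"

lemma subtree_subset:
  assumes "subtree G U S"
  shows "U \<subseteq> verts G" "U \<noteq> {}" "S \<subseteq> edges G" "e \<in> S \<Longrightarrow> ends G e \<subseteq> U"
  using assms by (induction) auto

lemma subtree_connected:
  assumes "subtree G U S" "x \<in> U" "y \<in> U"
  shows "reach G S x y"
  using assms
proof (induction arbitrary: x y)
  case (extend U S e u w)
  have w: "reach G (insert e S) u w" using extend by (auto intro: reach_edge)
  have "reach G (insert e S) x u" if "x \<in> insert w U" for x
  proof (cases "x = w")
    case True
    then show ?thesis using reach_sym[OF w] by simp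
  next
    case False
    then have "reach G S x u" using that extend.IH[of x u] extend.hyps by simp
    then show ?thesis by (rule reach_mono) (rule subset_insertI)
  qed
  from reach_trans[OF this reach_sym[OF this]] show ?case using extend.prems by blast
qed simp

text \<open>The edge added last is the only one at \<open>w\<close>, so removing it isolates
  \<open>w\<close>. For an older edge, a connection through the new edge can be contracted to one in
  the smaller subtree, where the induction hypothesis applies.\<close>

lemma subtree_bridge:
  assumes "subtree G U S" "e \<in> S" "ends G e = {x, y}"
  shows "\<not> reach G (S - {e}) x y"
  using assms
proof (induction arbitrary: e x y)
  case (extend U S f u w)
  note sub = subtree_subset[OF extend.hyps(1)]
  have f: "f \<notin> S" using sub(4)[of f] extend.hyps by auto
  show ?case
  proof
    assume r: "reach G (insert f S - {e}) x y"
    show False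
    proof (cases "e = f")
      case True
      then have "reach G S x y" using r f by simp
      moreover have "x = u \<and> y = w \<or> x = w \<and> y = u"
        using True extend.prems extend.hyps by (auto simp: doubleton_eq_iff)
      ultimately have "reach G S u w" using reach_sym[of G S w u] by auto
      then obtain g a b where "g \<in> S" "ends G g = {a, b}" "b \<notin> U"
        using reach_boundary[of G S u w U] extend.hyps by blast
      then show False using sub(4) by blast
    next
      case False
      then have e: "e \<in> S" using extend.prems by simp
      then have xy: "x \<in> U" "y \<in> U" using sub(4)[OF e] extend.prems by auto
      \<comment> \<open>Contracting the pendant edge \<open>f\<close> maps walks in \<open>insert f S\<close> to walks in \<open>S\<close>.\<close>
      have "reach G (S - {e}) ((id(w := u)) x) ((id(w := u)) y)"
      proof (rule reach_map[OF r])
        fix g a b assume g: "g \<in> insert f S - {e}" "ends G g = {a, b}"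
        show "reach G (S - {e}) ((id(w := u)) a) ((id(w := u)) b)"
        proof (cases "g = f")
          case True
          then have "a = u \<and> b = w \<or> a = w \<and> b = u"
            using g extend.hyps by (auto simp: doubleton_eq_iff)
          then show ?thesis by auto
        next
          case False
          then have "g \<in> S - {e}" "a \<in> U" "b \<in> U" using g sub(4)[of g] by auto
          moreover from this have "a \<noteq> w" "b \<noteq> w" using extend.hyps by auto
          moreover from calculation have "reach G (S - {e}) a b" using g by (intro reach_edge)
          ultimately show ?thesis by simp
        qed
      qed
      then have "reach G (S - {e}) x y" using xy extend.hyps by (simp split: if_splits)
      then show False using extend.IH[OF e extend.prems(2)] by simp
    qed
  qed
qed simp

lemma subtree_spanning_tree:
  assumes "subtree G (verts G) S"
  shows "S \<in> spanning_trees G"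
  unfolding spanning_trees_def connected_on_iff_reach
proof (intro CollectI conjI ballI)
  show "S \<subseteq> edges G" by (rule subtree_subset(3)[OF assms])
  show "reach G S x y" if "x \<in> verts G" "y \<in> verts G" for x y
    by (rule subtree_connected[OF assms that])
  show "\<nexists>x p. cycle G S x p" by (rule acyclicI[OF subtree_bridge[OF assms]])
qed

text \<open>Stated for a general \<open>A\<close> because it is applied both to all edges of the
  graph and to a spanning tree.\<close>

lemma connected_boundary:
  assumes "graph G" "connected_on G (verts G) A" "A \<subseteq> edges G" "subtree G U S" "U \<noteq> verts G"
  obtains e u w where "e \<in> A" "e \<in> edges G" "ends G e = {u, w}" "u \<in> U" "w \<in> verts G - U"
proof -
  obtain x y where "x \<in> U" "y \<in> verts G" "y \<notin> U" using subtree_subset[OF assms(4)] assms(5) by blast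
  moreover from this have "reach G A x y"
    using assms(2) subtree_subset(1)[OF assms(4)] by (auto simp: connected_on_iff_reach)
  ultimately obtain e u w where "e \<in> A" "ends G e = {u, w}" "u \<in> U" "w \<notin> U"
    using reach_boundary[of G A x y U] by blast
  moreover from this have "e \<in> edges G" "w \<in> verts G" using assms(1,3) by (auto simp: graph_def)
  ultimately show thesis using that by blast
qed

lemma subtree_extends_to_spanning_tree:
  assumes "graph G" "subtree G U S"
  shows "\<exists>T\<in>spanning_trees G. S \<subseteq> T"
  using assms(2)
proof (induction "card (verts G - U)" arbitrary: U S rule: less_induct)
  case less
  show ?case
  proof (cases "U = verts G")
    case True
    then show ?thesis using less.prems subtree_spanning_tree by blast
  next
    case False
    have "connected_on G (verts G) (edges G)" using assms(1) by (simp add: graph_def)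
    from this obtain e u w where e: "e \<in> edges G" "ends G e = {u, w}" "u \<in> U" "w \<in> verts G - U"
      by (rule connected_boundary[OF assms(1) _ order_refl less.prems False])
    have "card (verts G - insert w U) < card (verts G - U)"
      using assms(1) e by (intro psubset_card_mono) (auto simp: graph_def)
    from less.hyps[OF this subtree.extend[OF less.prems e]] show ?thesis by blast
  qed
qed

section \<open>Source-turn moves at the last vertex\<close>

lemma rotor_step_deterministic:
  "rotor_step G \<chi> s a b \<Longrightarrow> rotor_step G \<chi> s a c \<Longrightarrow> b = c"
  by (auto elim!: rotor_step.cases simp: doubleton_eq_iff)

text \<open>With the other end of \<open>\<chi> w e\<close> as sink, routing from the leaf
  \<open>w\<close> takes a single step. It changes only the rotor at \<open>w\<close>, because paths
  from \<open>U\<close> to the sink stay in \<open>S\<close>.\<close>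

lemma source_turn_move_pendant:
  assumes "graph G" "subtree G U S" "verts G = insert w U" "w \<notin> U"
    and "e \<in> incident G w" "\<chi> w e \<in> incident G w"
  shows "source_turn_move G \<chi> (insert e S) (insert (\<chi> w e) S)"
proof -
  have other: "\<exists>u\<in>U. g \<in> edges G \<and> ends G g = {u, w}" if "g \<in> incident G w" for g
  proof -
    \<comment> \<open>Two distinct ends exclude a loop at \<open>w\<close>, so the other end lies in
      \<open>U\<close>.\<close>
    have "card (ends G g) = 2" "ends G g \<subseteq> insert w U" "w \<in> ends G g" "g \<in> edges G"
      using that assms(1,3) by (auto simp: incident_def graph_def)
    then show ?thesis unfolding card_2_iff by auto
  qed
  have tree: "insert g S \<in> spanning_trees G" if "g \<in> incident G w" for g
    using other[OF that] subtree.extend[OF assms(2)] assms(3,4)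
    by (intro subtree_spanning_tree) auto
  note sub = subtree_subset[OF assms(2)]
  have edges_w: "{h \<in> insert g S. w \<in> ends G h} = {g}" if "g \<in> incident G w" for g
    using that sub(4) assms(4) by (auto simp: incident_def)
  let ?f = "\<chi> w e"
  obtain s where s: "s \<in> U" "ends G ?f = {s, w}" using other assms(6) by blast
  let ?R = "\<lambda>g. tree_rotor G (insert g S) s"
  have rotor_w: "?R g w = g" if g: "g \<in> incident G w" for g
  proof -
    have "reach G (insert g S) w s"
      using tree[OF g] s(1) assms(3) by (auto simp: spanning_trees_def connected_on_iff_reach)
    moreover have "w \<noteq> s" using s(1) assms(4) by blast
    ultimately obtain h v q where q: "path G (insert g S) w ((h, v) # q) s"
      by (rule reach_imp_path_Cons)
    \<comment> \<open>A path leaving \<open>w\<close> has to begin with the only tree edge at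
      \<open>w\<close>.\<close>
    then have "h = g" using path_ConsD(1,2)[OF q] edges_w[OF g] by auto
    then show ?thesis using tree_rotor_eq[OF tree[OF g] q] assms(3) by simp
  qed
  have rotor_U: "?R e x = ?R ?f x" if x: "x \<in> U" for x
  proof (cases "x = s")
    case False
    with subtree_connected[OF assms(2) x s(1)]
    obtain h v q where q: "path G S x ((h, v) # q) s" by (rule reach_imp_path_Cons)
    \<comment> \<open>The path inside \<open>S\<close> remains a path after any \<open>g\<close> is
      added, so \<open>h\<close> does not depend on \<open>g\<close>.\<close>
    have "?R g x = h" if g: "g \<in> incident G w" for g
    proof (rule tree_rotor_eq[OF tree[OF g] path_mono[OF q]])
      show "x \<in> verts G" using x assms(3) by simp
    qed (rule subset_insertI)
    then show ?thesis using assms(5,6) by simp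
  qed (simp add: tree_rotor_def)
  \<comment> \<open>An equality of functions: at the sink and off \<open>verts G\<close> both sides
    are \<open>undefined\<close>.\<close>
  have "?R ?f = (?R e)(w := ?f)"
  proof
    fix x
    show "?R ?f x = ((?R e)(w := ?f)) x"
      using rotor_U[of x] rotor_w[OF assms(6)] assms(3) by (cases "x \<in> verts G") (auto simp: tree_rotor_def)
  qed
  then have move: "rotor_step G \<chi> s (?R e, w) (?R ?f, s)"
    using s assms(4) rotor_w[OF assms(5)] by (intro rotor_step.intros) auto
  have "rotor_route G \<chi> s w (insert e S) = insert ?f S"
    unfolding rotor_route_def
  proof (intro the_equality conjI)
    fix T' assume T': "T' \<in> spanning_trees G \<and>
      (rotor_step G \<chi> s)\<^sup>*\<^sup>* (?R e, w) (tree_rotor G T' s, s)"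
    have stuck: "\<not> rotor_step G \<chi> s (?R ?f, s) c" for c by (auto elim: rotor_step.cases)
    \<comment> \<open>A run ending at \<open>s\<close> is nonempty as \<open>w\<close> differs from
      \<open>s\<close>; by determinism it begins with \<open>move\<close>, and no step leaves the
      sink.\<close>
    have "tree_rotor G T' s = ?R ?f"
      using conjunct2[OF T']
    proof (cases rule: converse_rtranclpE)
      case base
      then show ?thesis using s(1) assms(4) by simp
    next
      case (step c)
      then have "c = (?R ?f, s)" using rotor_step_deterministic[OF move] by simp
      then have "(rotor_step G \<chi> s)\<^sup>*\<^sup>* (?R ?f, s) (tree_rotor G T' s, s)" using step by simp
      then show ?thesis using stuck by (cases rule: converse_rtranclpE) auto
    qed
    moreover have "s \<in> verts G" using s(1) assms(3) by simp
    note image = tree_rotor_image[OF assms(1) _ this]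
    ultimately show "T' = insert ?f S"
      using image[OF conjunct1[OF T']] image[OF tree[OF assms(6)]] by argo
  qed (use tree[OF assms(6)] move in auto)
  moreover have "source_turn_pair G \<chi> w s (insert e S)"
    unfolding source_turn_pair_def leaf_vertex_def rotor_w[OF assms(5)] edges_w[OF assms(5)]
    using s assms(3,4) tree[OF assms(5)] by (simp add: insert_commute) blast
  ultimately show ?thesis unfolding source_turn_move_def by blast
qed

text \<open>The permutation \<open>\<chi> w\<close> has a single orbit on the edges at
  \<open>w\<close>, so repeated turning reaches \<open>f\<close>. As \<open>orbit\<close> requires
  at least one application, the case \<open>f = e\<close> is a full turn.\<close>

lemma source_turn_moves_pendant:
  assumes "ribbon_graph G \<chi>" "subtree G U S" "verts G = insert w U" "w \<notin> U"
    and "e \<in> incident G w" "f \<in> incident G w"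
  shows "(source_turn_move G \<chi>)\<^sup>*\<^sup>* (insert e S) (insert f S)"
proof -
  have cyc: "cyclic_on (\<chi> w) (incident G w)"
    using assms unfolding ribbon_graph_def ribbon_structure_def by blast
  have "graph G" using assms(1) by (simp add: ribbon_graph_def)
  then have move: "source_turn_move G \<chi> (insert g S) (insert (\<chi> w g) S)" if "g \<in> incident G w" for g
    using cyclic_on_inI[OF cyc that] by (intro source_turn_move_pendant[OF _ assms(2-4) that])
  have "f \<in> orbit (\<chi> w) e"
    using orbit_cyclic_eq3[OF cyc assms(5)] assms(6) by simp
  then show ?thesis
  proof induction
    case base
    show ?case using move[OF assms(5)] by blast
  next
    case (step g)
    have "g \<in> incident G w" using step.hyps orbit_cyclic_eq3[OF cyc assms(5)] by simp
    from step.IH move[OF this] show ?case by (rule rtranclp.rtrancl_into_rtrancl)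
  qed
qed

section \<open>Linking all spanning trees over a common subtree\<close>

lemma source_turn_moves_over_subtree:
  assumes "ribbon_graph G \<chi>" "two_connected G"
    and "subtree G U S" "T \<in> spanning_trees G" "S \<subseteq> T" "T' \<in> spanning_trees G" "S \<subseteq> T'"
  shows "(source_turn_move G \<chi>)\<^sup>*\<^sup>* T T'"
  using assms(3-)
proof (induction "card (verts G - U)" arbitrary: U S T T' rule: less_induct)
  case less
  let ?move = "(source_turn_move G \<chi>)\<^sup>*\<^sup>*"
  have graph: "graph G" using assms(2) by (simp add: two_connected_def)
  note sub = subtree_subset[OF less.prems(1)]
  define exits where "exits e u w \<longleftrightarrow> e \<in> edges G \<and> ends G e = {u, w} \<and> u \<in> U \<and> w \<in> verts G - U"
    for e u w
  have ex: "\<exists>e u w. e \<in> T \<and> exits e u w" if "T \<in> spanning_trees G" "U \<noteq> verts G" for T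
  proof -
    have "connected_on G (verts G) T" "T \<subseteq> edges G" using that(1) by (simp_all add: spanning_trees_def)
    from connected_boundary[OF graph this less.prems(1) that(2)]
    obtain e u w where "e \<in> T" "e \<in> edges G" "ends G e = {u, w}" "u \<in> U" "w \<in> verts G - U" .
    then show ?thesis unfolding exits_def by blast
  qed
  \<comment> \<open>The induction hypothesis is used here, for the larger common subtree
    \<open>insert e S\<close> on \<open>insert w U\<close>.\<close>
  have same: "?move T T'"
    if "exits e u w" "T \<in> spanning_trees G" "S \<subseteq> T" "e \<in> T" "T' \<in> spanning_trees G" "S \<subseteq> T'" "e \<in> T'"
    for e u w T T'
  proof -
    have "card (verts G - insert w U) < card (verts G - U)"
      using graph that(1) by (intro psubset_card_mono) (auto simp: graph_def exits_def)
    then show ?thesis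
      using that(1) by (intro less.hyps[OF _ subtree.extend[OF less.prems(1)]])
        (use that in \<open>auto simp: exits_def\<close>)
  qed
  have diff: "?move T T'"
    if e: "exits e u w" "T \<in> spanning_trees G" "S \<subseteq> T" "e \<in> T"
      and f: "exits f v z" "T' \<in> spanning_trees G" "S \<subseteq> T'" "f \<in> T'" and "w \<noteq> z"
    for e u w f v z T T'
  proof -
    \<comment> \<open>Since \<open>w\<close> and \<open>z\<close> differ, \<open>z\<close> is still
      outside after \<open>w\<close> has been added. A spanning tree \<open>R\<close> over this
      subtree contains both exits and serves as an intermediate stop.\<close>
    have "subtree G (insert z (insert w U)) (insert f (insert e S))"
      using e(1) f(1) \<open>w \<noteq> z\<close> less.prems(1) unfolding exits_def
      by (intro subtree.extend) auto
    then obtain R where "R \<in> spanning_trees G" "insert f (insert e S) \<subseteq> R"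
      using subtree_extends_to_spanning_tree[OF graph] by blast
    then have "?move T R" "?move R T'"
      using same[OF e, of R] same[OF f(1), of R T'] f by auto
    then show ?thesis by (rule rtranclp_trans)
  qed
  show ?case
  proof (cases "U = verts G")
    case True
    \<comment> \<open>Here \<open>S\<close> itself spans, so by minimality both trees equal
      \<open>S\<close>.\<close>
    then have "S = R" if "R \<in> spanning_trees G" "S \<subseteq> R" for R
      using spanning_tree_minimal[OF graph that] subtree_spanning_tree less.prems(1)
      by (auto simp: spanning_trees_def)
    from this[OF less.prems(2,3)] this[OF less.prems(4,5)] show ?thesis by simp
  next
    case False
    obtain e u w where e: "e \<in> T" "exits e u w" using ex[OF less.prems(2) False] by blast
    obtain f v z where f: "f \<in> T'" "exits f v z" using ex[OF less.prems(4) False] by blast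
    show ?thesis
    proof (cases "w = z")
      case False
      then show ?thesis by (rule diff[OF e(2) less.prems(2,3) e(1) f(2) less.prems(4,5) f(1)])
    next
      case wz: True
      show ?thesis
      proof (cases "\<exists>h a b. exits h a b \<and> b \<noteq> w")
        case True
        then obtain h a b where h: "exits h a b" "b \<noteq> w" by blast
        then obtain R where "R \<in> spanning_trees G" "insert h S \<subseteq> R"
          using subtree_extends_to_spanning_tree[OF graph subtree.extend[OF less.prems(1)]]
          unfolding exits_def by blast
        \<comment> \<open>The outer end of \<open>h\<close> differs from the common outer end of
          \<open>e\<close> and \<open>f\<close>, so \<open>diff\<close> applies on both sides of
          \<open>R\<close>.\<close>
        then have "?move T R" "?move R T'"
          using diff[OF e(2) less.prems(2,3) e(1) h(1)] diff[OF h(1) _ _ _ f(2) less.prems(4,5) f(1)] h wz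
          by auto
        then show ?thesis by (rule rtranclp_trans)
      next
        case only_w: False
        have V: "verts G = insert w U"
        proof (rule ccontr)
          assume "verts G \<noteq> insert w U"
          then obtain y where y: "y \<in> verts G - {w}" "y \<notin> U" using sub(1) e(2) by (auto simp: exits_def)
          \<comment> \<open>The absence of cut vertices enters here: a walk from \<open>u\<close> to
            \<open>y\<close> avoiding \<open>w\<close> leaves \<open>U\<close> by an edge whose
            outer end is not \<open>w\<close>.\<close>
          have "reach G {g \<in> edges G. w \<notin> ends G g} u y"
            using assms(2) e(2) sub(1) y
            by (auto simp: two_connected_def cut_vertex_def connected_on_iff_reach exits_def)
          then obtain g a b where "g \<in> edges G" "w \<notin> ends G g" "ends G g = {a, b}" "a \<in> U" "b \<notin> U"
            using reach_boundary[of G _ u y U] e(2) y unfolding exits_def by blast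
          moreover from this have "b \<in> verts G" using graph by (auto simp: graph_def)
          ultimately show False using only_w unfolding exits_def by auto
        qed
        \<comment> \<open>As \<open>w\<close> is the only vertex left, \<open>S\<close> with one
          edge at \<open>w\<close> already spans, so \<open>R\<close> contains nothing more.\<close>
        have tree: "insert g S = R"
          if "exits g a w" "g \<in> R" "R \<in> spanning_trees G" "S \<subseteq> R" for g a R
        proof -
          have "insert g S \<in> spanning_trees G"
            using subtree.extend[OF less.prems(1)] that(1) V
            by (intro subtree_spanning_tree) (auto simp: exits_def)
          then show ?thesis using spanning_tree_minimal[OF graph that(3)] that
            by (auto simp: spanning_trees_def)
        qed
        have "?move (insert e S) (insert f S)"
          using source_turn_moves_pendant[OF assms(1) less.prems(1) V] e f wz
          by (auto simp: exits_def incident_def)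
        then show ?thesis
          using tree[OF e(2,1) less.prems(2,3)] tree[of f v T'] f wz less.prems(4,5) by simp
      qed
    qed
  qed
qed

theorem theorem5p8:
  fixes G :: "('v, 'e) multigraph" and \<chi> :: "'v \<Rightarrow> 'e \<Rightarrow> 'e"
    and Tstart Tgoal :: "'e set"
  assumes "ribbon_graph G \<chi>"
    and "two_connected G"
    and "Tstart \<in> spanning_trees G"
    and "Tgoal \<in> spanning_trees G"
  shows "(source_turn_move G \<chi>)\<^sup>*\<^sup>* Tstart Tgoal"
proof -
  \<comment> \<open>Any vertex, with no edges, is a subtree common to both trees.\<close>
  obtain r where "r \<in> verts G"
    using assms(2) by (auto simp: two_connected_def graph_def)
  then show ?thesis
    using source_turn_moves_over_subtree[OF assms(1,2) subtree.single] assms(3,4) by blast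
qed

end
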